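(* Let $S$ be a finite semigroup and let $T_1, T_2$ be subsemigroups of $S$ such that $T_1\cup T_2$ generates $S$. Let $T_0 := \langle T_1T_2\rangle$ be the subsemigroup of $S$ generated by the set $T_1T_2=\{t_1t_2 : t_1\in T_1, t_2\in T_2\}$. Then $S$ divides a triple product of $T_2^\flat$, $(T_0^I)^{T_1^I\times T_2^I}$, and $T_1^\sharp$; that is, there are a left action of $T_1^\sharp$ and a right action of $T_2^\flat$ on the semigroup $(T_0^I)^{T_1^I\times T_2^I}$, which commute, such that $S$ divides the resulting triple product $\bigl(T_2^\flat,\,(T_0^I)^{T_1^I\times T_2^I},\,T_1^\sharp\bigr)$.
   Context: A semigroup $S$ divides a semigroup $T$ if $S$ is a homomorphic image of a subsemigroup of $T$. For a semigroup $T$, $T^I$ is the monoid obtained by adjoining a new identity $I$ to $T$ (even if $T$ is already a monoid). $T^\sharp$ is the semigroup of functions on $T^I$, acting on the right of their arguments (and composed accordingly), consisting of the right multiplication maps $x\mapsto xt$ for $t\in T$ and the constant maps with value $t$ for $t\in T^I$. Dually, $T^\flat$ is the semigroup of functions on $T^I$, acting on the left of their arguments, consisting of the left multiplication maps $x\mapsto tx$ for $t\in T$ and the constant maps with value $t$ for $t\in T^I$. $(T_0^I)^{T_1^I\times T_2^I}$ is the semigroup of all functions $T_1^I\times T_2^I\to T_0^I$ with pointwise product. Triple product: let $(R,+)$ be a (not necessarily commutative) semigroup with a left action of a semigroup $R_L$ and a right action of a semigroup $R_R$, both by semigroup endomorphisms, which commute, i.e. $(r_Lr)r_R = r_L(rr_R)$.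 The triple product $(R_R,R,R_L)$ is the semigroup of triples $(r_R,r,r_L)$ with multiplication $(r_R,r,r_L)(r_R',r',r_L') := (r_Rr_R',\, rr_R'+r_Lr',\, r_Lr_L')$. *)

theory Defs
  imports "HOL-Algebra.Congruence" "HOL-Library.FuncSet"
begin

section \<open>Semigroups with explicit carriers\<close>

record 'a magma = "'a partial_object" +
  mult :: "'a \<Rightarrow> 'a \<Rightarrow> 'a"  (infixl "\<otimes>\<index>" 70)

text \<open>The empty semigroup is admitted; nothing below depends on non-emptiness.\<close>

locale sgrp =
  fixes S :: "('a, 'm) magma_scheme"  (structure)
  assumes closed: "\<lbrakk>x \<in> carrier S; y \<in> carrier S\<rbrakk> \<Longrightarrow> x \<otimes> y \<in> carrier S"
    and assoc: "\<lbrakk>x \<in> carrier S; y \<in> carrier S; z \<in> carrier S\<rbrakk>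
                  \<Longrightarrow> (x \<otimes> y) \<otimes> z = x \<otimes> (y \<otimes> z)"

locale subsgrp =
  fixes H :: "'a set" and S :: "('a, 'm) magma_scheme"  (structure)
  assumes subset: "H \<subseteq> carrier S"
    and closed: "\<lbrakk>x \<in> H; y \<in> H\<rbrakk> \<Longrightarrow> x \<otimes> y \<in> H"

text \<open>As for groups in HOL-Algebra, a subsemigroup \<open>H\<close> of \<open>S\<close> is regarded as a semigroup in its
  own right by writing \<open>S\<lparr>carrier := H\<rparr>\<close>.\<close>

lemma subsgrp_imp_sgrp:
  assumes "sgrp S" "subsgrp H S"
  shows "sgrp (S\<lparr>carrier := H\<rparr>)"
  using assms by (auto simp: sgrp_def subsgrp_def subset_iff)

inductive_set sgrp_generate :: "('a, 'm) magma_scheme \<Rightarrow> 'a set \<Rightarrow> 'a set"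
  for S :: "('a, 'm) magma_scheme" and A :: "'a set" where
  incl: "a \<in> A \<Longrightarrow> a \<in> sgrp_generate S A"
| mult: "\<lbrakk>x \<in> sgrp_generate S A; y \<in> sgrp_generate S A\<rbrakk> \<Longrightarrow> x \<otimes>\<^bsub>S\<^esub> y \<in> sgrp_generate S A"

lemma sgrp_generate_subsgrp:
  assumes "sgrp S" "A \<subseteq> carrier S"
  shows "subsgrp (sgrp_generate S A) S"
proof
  show "sgrp_generate S A \<subseteq> carrier S"
  proof
    fix x assume "x \<in> sgrp_generate S A"
    then show "x \<in> carrier S"
      by (induction rule: sgrp_generate.induct) (use assms in \<open>auto intro: sgrp.closed\<close>)
  qed
qed (rule sgrp_generate.mult)

definition set_product :: "('a, 'm) magma_scheme \<Rightarrow> 'a set \<Rightarrow> 'a set \<Rightarrow> 'a set" where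
  "set_product S A B = {a \<otimes>\<^bsub>S\<^esub> b | a b. a \<in> A \<and> b \<in> B}"

definition sgrp_hom :: "('a, 'm) magma_scheme \<Rightarrow> ('b, 'n) magma_scheme \<Rightarrow> ('a \<Rightarrow> 'b) set" where
  "sgrp_hom S T = {h. h \<in> carrier S \<rightarrow> carrier T \<and>
     (\<forall>x\<in>carrier S. \<forall>y\<in>carrier S. h (x \<otimes>\<^bsub>S\<^esub> y) = h x \<otimes>\<^bsub>T\<^esub> h y)}"

definition sgrp_divides :: "('a, 'm) magma_scheme \<Rightarrow> ('b, 'n) magma_scheme \<Rightarrow> bool" where
  "sgrp_divides S T \<longleftrightarrow>
     (\<exists>U h. subsgrp U T \<and> h \<in> sgrp_hom (T\<lparr>carrier := U\<rparr>) S \<and> h ` U = carrier S)"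


section \<open>Adjoining an identity; the semigroups \<open>T\<^sup>\<sharp>\<close> and \<open>T\<^sup>\<flat>\<close>\<close>

text \<open>\<open>adj_id T\<close> is \<open>T\<^sup>I\<close>: the new identity \<open>I\<close> is \<^term>\<open>None\<close>, and \<open>t\<close> is identified with
  \<^term>\<open>Some t\<close>.\<close>

fun adj_mult :: "('a \<Rightarrow> 'a \<Rightarrow> 'a) \<Rightarrow> 'a option \<Rightarrow> 'a option \<Rightarrow> 'a option" where
  "adj_mult f None y = y"
| "adj_mult f (Some x) None = Some x"
| "adj_mult f (Some x) (Some y) = Some (f x y)"

definition adj_id :: "('a, 'm) magma_scheme \<Rightarrow> 'a option magma" where
  "adj_id T = \<lparr>carrier = insert None (Some ` carrier T), mult = adj_mult (mult T)\<rparr>"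

lemma adj_id_sgrp:
  assumes "sgrp T" shows "sgrp (adj_id T)"
  using assms by (auto simp: sgrp_def adj_id_def)

text \<open>Functions on \<open>T\<^sup>I\<close> are represented by HOL functions that are extensional on its carrier, so
  that equality in \<open>sharp T\<close> and \<open>flat T\<close> is equality of functions on \<open>T\<^sup>I\<close>. Elements of \<open>sharp T\<close>
  act on the right of their arguments: in the product of \<open>f\<close> and \<open>g\<close>, \<open>f\<close> is applied first, and
  what is written \<open>x f\<close> on paper is \<open>f x\<close> here.\<close>

definition sharp :: "('a, 'm) magma_scheme \<Rightarrow> ('a option \<Rightarrow> 'a option) magma" where
  "sharp T =
     \<lparr>carrier = {\<lambda>x\<in>carrier (adj_id T). x \<otimes>\<^bsub>adj_id T\<^esub> Some t | t. t \<in> carrier T}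
              \<union> {\<lambda>x\<in>carrier (adj_id T). t | t. t \<in> carrier (adj_id T)},
      mult = (\<lambda>f g. \<lambda>x\<in>carrier (adj_id T). g (f x))\<rparr>"

definition flat :: "('a, 'm) magma_scheme \<Rightarrow> ('a option \<Rightarrow> 'a option) magma" where
  "flat T =
     \<lparr>carrier = {\<lambda>x\<in>carrier (adj_id T). Some t \<otimes>\<^bsub>adj_id T\<^esub> x | t. t \<in> carrier T}
              \<union> {\<lambda>x\<in>carrier (adj_id T). t | t. t \<in> carrier (adj_id T)},
      mult = (\<lambda>f g. \<lambda>x\<in>carrier (adj_id T). f (g x))\<rparr>"

lemma sharp_sgrp:
  assumes "sgrp T" shows "sgrp (sharp T)"
proof -
  interpret I: sgrp "adj_id T" by (rule adj_id_sgrp[OF assms])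
  have [simp]: "Some t \<in> carrier (adj_id T) \<longleftrightarrow> t \<in> carrier T" for t
    by (auto simp: adj_id_def)
  have maps: "f x \<in> carrier (adj_id T)" if "f \<in> carrier (sharp T)" "x \<in> carrier (adj_id T)" for f x
    using that by (auto simp: sharp_def I.closed)
  show ?thesis
  proof
    fix f g assume f: "f \<in> carrier (sharp T)" and g: "g \<in> carrier (sharp T)"
    let ?c = "carrier (adj_id T)"
    have "(\<lambda>x\<in>?c. g (f x)) \<in> carrier (sharp T)"
    proof (cases "\<exists>t\<in>?c. f = (\<lambda>x\<in>?c. t)")
      case True
      then obtain t where "t \<in> ?c" "f = (\<lambda>x\<in>?c. t)" by blast
      then have "(\<lambda>x\<in>?c. g (f x)) = (\<lambda>x\<in>?c. g t)" "g t \<in> ?c"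
        using maps[OF g] by (auto simp: fun_eq_iff)
      then show ?thesis by (auto simp: sharp_def)
    next
      case False
      then obtain t where t: "t \<in> carrier T" "f = (\<lambda>x\<in>?c. x \<otimes>\<^bsub>adj_id T\<^esub> Some t)"
        using f by (auto simp: sharp_def)
      consider u where "u \<in> ?c" "g = (\<lambda>x\<in>?c. u)"
        | u where "u \<in> carrier T" "g = (\<lambda>x\<in>?c. x \<otimes>\<^bsub>adj_id T\<^esub> Some u)"
        using g by (auto simp: sharp_def)
      then show ?thesis
      proof cases
        case 1
        then have "(\<lambda>x\<in>?c. g (f x)) = (\<lambda>x\<in>?c. u)"
          using maps[OF f] by (auto simp: fun_eq_iff)
        then show ?thesis using 1 by (auto simp: sharp_def)
      next
        case 2
        have "(\<lambda>x\<in>?c. g (f x)) = (\<lambda>x\<in>?c. x \<otimes>\<^bsub>adj_id T\<^esub> Some (t \<otimes>\<^bsub>T\<^esub> u))"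
        proof (rule restrict_ext)
          fix x assume x: "x \<in> ?c"
          have "g (f x) = (x \<otimes>\<^bsub>adj_id T\<^esub> Some t) \<otimes>\<^bsub>adj_id T\<^esub> Some u"
            using x t 2 maps[OF f x] by simp
          also have "\<dots> = x \<otimes>\<^bsub>adj_id T\<^esub> (Some t \<otimes>\<^bsub>adj_id T\<^esub> Some u)"
            using x t 2 by (intro I.assoc) simp_all
          finally show "g (f x) = x \<otimes>\<^bsub>adj_id T\<^esub> Some (t \<otimes>\<^bsub>T\<^esub> u)" by (simp add: adj_id_def)
        qed
        then show ?thesis using t 2 sgrp.closed[OF assms] by (auto simp: sharp_def)
      qed
    qed
    then show "f \<otimes>\<^bsub>sharp T\<^esub> g \<in> carrier (sharp T)" by (simp add: sharp_def)
  next
    fix f g h assume f: "f \<in> carrier (sharp T)"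
    show "(f \<otimes>\<^bsub>sharp T\<^esub> g) \<otimes>\<^bsub>sharp T\<^esub> h = f \<otimes>\<^bsub>sharp T\<^esub> (g \<otimes>\<^bsub>sharp T\<^esub> h)"
      using maps[OF f] by (auto simp: sharp_def[of T] fun_eq_iff)
  qed
qed

text \<open>The two constructions are dual.\<close>

lemma flat_eq_sharp_opposite:
  "carrier (flat T) = carrier (sharp (T\<lparr>mult := \<lambda>x y. y \<otimes>\<^bsub>T\<^esub> x\<rparr>))"
  "f \<otimes>\<^bsub>flat T\<^esub> g = g \<otimes>\<^bsub>sharp (T\<lparr>mult := \<lambda>x y. y \<otimes>\<^bsub>T\<^esub> x\<rparr>)\<^esub> f"
proof -
  have [simp]: "adj_mult (\<lambda>x y. y \<otimes>\<^bsub>T\<^esub> x) x y = adj_mult (mult T) y x" for x y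
    by (cases x; cases y) auto
  show "carrier (flat T) = carrier (sharp (T\<lparr>mult := \<lambda>x y. y \<otimes>\<^bsub>T\<^esub> x\<rparr>))"
    by (simp add: flat_def sharp_def adj_id_def)
  show "f \<otimes>\<^bsub>flat T\<^esub> g = g \<otimes>\<^bsub>sharp (T\<lparr>mult := \<lambda>x y. y \<otimes>\<^bsub>T\<^esub> x\<rparr>)\<^esub> f"
    by (simp add: flat_def sharp_def adj_id_def)
qed

lemma flat_sgrp:
  assumes "sgrp T" shows "sgrp (flat T)"
proof -
  have "sgrp (T\<lparr>mult := \<lambda>x y. y \<otimes>\<^bsub>T\<^esub> x\<rparr>)"
    using assms by (auto simp: sgrp_def)
  then have "sgrp (sharp (T\<lparr>mult := \<lambda>x y. y \<otimes>\<^bsub>T\<^esub> x\<rparr>))"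
    by (rule sharp_sgrp)
  then show ?thesis
    by (simp add: sgrp_def flat_eq_sharp_opposite)
qed


section \<open>Function semigroups and triple products\<close>

definition fun_sgrp :: "'i set \<Rightarrow> ('a, 'm) magma_scheme \<Rightarrow> ('i \<Rightarrow> 'a) magma" where
  "fun_sgrp A S = \<lparr>carrier = A \<rightarrow>\<^sub>E carrier S, mult = (\<lambda>f g. \<lambda>x\<in>A. f x \<otimes>\<^bsub>S\<^esub> g x)\<rparr>"

lemma fun_sgrp_sgrp:
  assumes "sgrp S" shows "sgrp (fun_sgrp A S)"
  using assms by (auto simp: sgrp_def fun_sgrp_def PiE_iff fun_eq_iff)

locale left_endo_action = L: sgrp L + R: sgrp R
  for L :: "('l, 'm) magma_scheme" and R :: "('r, 'n) magma_scheme" +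
  fixes lact :: "'l \<Rightarrow> 'r \<Rightarrow> 'r"
  assumes lact_closed: "\<lbrakk>l \<in> carrier L; r \<in> carrier R\<rbrakk> \<Longrightarrow> lact l r \<in> carrier R"
    and lact_mult: "\<lbrakk>l \<in> carrier L; l' \<in> carrier L; r \<in> carrier R\<rbrakk>
          \<Longrightarrow> lact (l \<otimes>\<^bsub>L\<^esub> l') r = lact l (lact l' r)"
    and lact_endo: "\<lbrakk>l \<in> carrier L; r \<in> carrier R; r' \<in> carrier R\<rbrakk>
          \<Longrightarrow> lact l (r \<otimes>\<^bsub>R\<^esub> r') = lact l r \<otimes>\<^bsub>R\<^esub> lact l r'"

locale right_endo_action = K: sgrp K + R: sgrp R
  for K :: "('k, 'm) magma_scheme" and R :: "('r, 'n) magma_scheme" +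
  fixes ract :: "'r \<Rightarrow> 'k \<Rightarrow> 'r"
  assumes ract_closed: "\<lbrakk>k \<in> carrier K; r \<in> carrier R\<rbrakk> \<Longrightarrow> ract r k \<in> carrier R"
    and ract_mult: "\<lbrakk>k \<in> carrier K; k' \<in> carrier K; r \<in> carrier R\<rbrakk>
          \<Longrightarrow> ract r (k \<otimes>\<^bsub>K\<^esub> k') = ract (ract r k) k'"
    and ract_endo: "\<lbrakk>k \<in> carrier K; r \<in> carrier R; r' \<in> carrier R\<rbrakk>
          \<Longrightarrow> ract (r \<otimes>\<^bsub>R\<^esub> r') k = ract r k \<otimes>\<^bsub>R\<^esub> ract r' k"

locale triple_product_data =
  left_endo_action L R lact + right_endo_action K R ract
  for K :: "('k, 'm) magma_scheme" and R :: "('r, 'n) magma_scheme"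
    and L :: "('l, 'o) magma_scheme"
    and lact :: "'l \<Rightarrow> 'r \<Rightarrow> 'r" and ract :: "'r \<Rightarrow> 'k \<Rightarrow> 'r" +
  assumes actions_commute: "\<lbrakk>l \<in> carrier L; r \<in> carrier R; k \<in> carrier K\<rbrakk>
          \<Longrightarrow> ract (lact l r) k = lact l (ract r k)"

text \<open>\<open>K\<close>, \<open>R\<close>, \<open>L\<close> play the roles of \<open>R\<^sub>R\<close>, \<open>R\<close>, \<open>R\<^sub>L\<close>; the operation of \<open>R\<close>, usually written
  additively, is its \<open>mult\<close>.\<close>

definition triple_product ::
  "('k, 'm) magma_scheme \<Rightarrow> ('r, 'n) magma_scheme \<Rightarrow> ('l, 'o) magma_scheme
    \<Rightarrow> ('l \<Rightarrow> 'r \<Rightarrow> 'r) \<Rightarrow> ('r \<Rightarrow> 'k \<Rightarrow> 'r) \<Rightarrow> ('k \<times> 'r \<times> 'l) magma" where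
  "triple_product K R L lact ract =
     \<lparr>carrier = carrier K \<times> carrier R \<times> carrier L,
      mult = (\<lambda>(k, r, l) (k', r', l').
                (k \<otimes>\<^bsub>K\<^esub> k', ract r k' \<otimes>\<^bsub>R\<^esub> lact l r', l \<otimes>\<^bsub>L\<^esub> l'))\<rparr>"

lemma (in triple_product_data) triple_product_sgrp:
  "sgrp (triple_product K R L lact ract)"
  by (auto simp: sgrp_def triple_product_def K.closed K.assoc L.closed L.assoc R.closed R.assoc
        lact_closed ract_closed lact_mult ract_mult lact_endo ract_endo actions_commute)

end

theory Submission
  imports Defs
begin

text \<open>
  Write an element of \<open>S\<close> as a word \<open>w\<close> in letters from \<open>T\<^sub>1\<close> and \<open>T\<^sub>2\<close>, keeping track of which
  of the two each letter is taken from, and cut the word after each block of letters from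
  \<open>T\<^sub>2\<close>. Multiplying out gives a prefix in \<open>T\<^sub>2\<^sup>I\<close>, a middle part that is a product of elements of
  \<open>T\<^sub>1T\<^sub>2\<close>, hence lies in \<open>T\<^sub>0\<^sup>I\<close>, and a suffix in \<open>T\<^sub>1\<^sup>I\<close>.

  To make this multiplicative, the word is read in all contexts \<open>x w y\<close> with \<open>x \<in> T\<^sub>1\<^sup>I\<close> and
  \<open>y \<in> T\<^sub>2\<^sup>I\<close>. Let \<open>k y\<close> be the \<open>T\<^sub>2\<close>-prefix of \<open>w y\<close>, let \<open>l x\<close> be the \<open>T\<^sub>1\<close>-suffix of \<open>x w\<close>, and
  let \<open>r (x, y)\<close> be the product of those pieces of \<open>T\<^sub>1T\<^sub>2\<close> in \<open>x w y\<close> whose \<open>T\<^sub>1\<close>-block ends inside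
  \<open>w\<close>. If \<open>w\<close> lies entirely in \<open>T\<^sub>2\<close> then \<open>k\<close> is a left multiplication, and otherwise it is
  constant, so \<open>k \<in> T\<^sub>2\<^sup>\<flat>\<close>; dually \<open>l \<in> T\<^sub>1\<^sup>\<sharp>\<close>. In a product \<open>w w'\<close> the factor \<open>w\<close> sees
  \<open>k' y\<close> to its right, and \<open>w'\<close> sees \<open>l x\<close> to its left, so the middle part of \<open>w w'\<close> at \<open>(x, y)\<close> is
  \<open>r (x, k' y)\<close> times \<open>r' (l x, y)\<close>. Charging each piece to the end of its \<open>T\<^sub>1\<close>-block is what
  prevents a piece that straddles the boundary between \<open>w\<close> and \<open>w'\<close> from being counted in both
  factors. This is exactly the multiplication of a triple product in which
  \<open>T\<^sub>1\<^sup>\<sharp>\<close> and \<open>T\<^sub>2\<^sup>\<flat>\<close> act by precomposition in the two arguments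
  (\<open>precomposition_triple_product_data\<close>).

  The word itself need not be mentioned: the relation \<open>represents\<close> below records
  how the triple \<open>(k, r, l)\<close> determines \<open>s\<close>, the value of \<open>w\<close>, in every context. It is
  multiplicative (\<open>represents_mult\<close>), both kinds of letters have such triples
  (\<open>represents_right_letter\<close>, \<open>represents_left_letter\<close>), and evaluating in the trivial context
  \<open>x = y = I\<close> recovers \<open>s\<close> as \<open>(k I) (r (I, I)) (l I)\<close> (\<open>represents_value\<close>). Hence
  the triples that represent some element form a subsemigroup, which maps onto \<open>S\<close>.
\<close>

lemma adj_id_carrier_simps [simp]:
  "None \<in> carrier (adj_id T)"
  "Some t \<in> carrier (adj_id T) \<longleftrightarrow> t \<in> carrier T"
  by (auto simp: adj_id_def)

lemma adj_id_mult_simps [simp]: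
  "None \<otimes>\<^bsub>adj_id T\<^esub> y = y"
  "x \<otimes>\<^bsub>adj_id T\<^esub> None = x"
  "Some t \<otimes>\<^bsub>adj_id T\<^esub> Some u = Some (t \<otimes>\<^bsub>T\<^esub> u)"
  by (cases x; simp add: adj_id_def)+

lemma adj_id_restrict_mult [simp]:
  "x \<otimes>\<^bsub>adj_id (T\<lparr>carrier := A\<rparr>)\<^esub> y = x \<otimes>\<^bsub>adj_id T\<^esub> y"
  by (simp add: adj_id_def)

lemma adj_id_restrict_carrier:
  "A \<subseteq> carrier T \<Longrightarrow> x \<in> carrier (adj_id (T\<lparr>carrier := A\<rparr>)) \<Longrightarrow> x \<in> carrier (adj_id T)"
  by (auto simp: adj_id_def)

lemma sharp_maps:
  assumes "sgrp T" "l \<in> carrier (sharp T)" "x \<in> carrier (adj_id T)"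
  shows "l x \<in> carrier (adj_id T)"
  using assms sgrp.closed[OF adj_id_sgrp[OF assms(1)]] by (auto simp: sharp_def)

lemma flat_maps:
  assumes "sgrp T" "k \<in> carrier (flat T)" "y \<in> carrier (adj_id T)"
  shows "k y \<in> carrier (adj_id T)"
  using assms sgrp.closed[OF adj_id_sgrp[OF assms(1)]] by (auto simp: flat_def)

definition left_precomp where
  "left_precomp A B l r = (\<lambda>(x, y)\<in>A \<times> B. r (l x, y))"

definition right_precomp where
  "right_precomp A B r k = (\<lambda>(x, y)\<in>A \<times> B. r (x, k y))"

text \<open>Maps acting on the right of their arguments act on the left of functions by
  precomposition, and conversely; precompositions in different arguments commute, and they
  respect every pointwise operation.\<close>

lemma precomposition_triple_product_data:
  fixes T\<^sub>1 :: "('a, 'm) magma_scheme" and T\<^sub>2 :: "('b, 'n) magma_scheme"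
    and Q :: "('c, 'o) magma_scheme"
  assumes "sgrp T\<^sub>1" "sgrp T\<^sub>2" "sgrp Q"
  defines "A \<equiv> carrier (adj_id T\<^sub>1)" and "B \<equiv> carrier (adj_id T\<^sub>2)"
  shows "triple_product_data (flat T\<^sub>2) (fun_sgrp (A \<times> B) Q) (sharp T\<^sub>1)
           (left_precomp A B) (right_precomp A B)"
proof -
  have l: "l x \<in> A" if "l \<in> carrier (sharp T\<^sub>1)" "x \<in> A" for l x
    using sharp_maps assms that by (simp add: A_def)
  have k: "k y \<in> B" if "k \<in> carrier (flat T\<^sub>2)" "y \<in> B" for k y
    using flat_maps assms that by (simp add: B_def)
  have sharp_mult: "(l \<otimes>\<^bsub>sharp T\<^sub>1\<^esub> l') x = l' (l x)" if "x \<in> A" for l l' x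
    using that by (simp add: sharp_def A_def)
  have flat_mult: "(k \<otimes>\<^bsub>flat T\<^sub>2\<^esub> k') y = k (k' y)" if "y \<in> B" for k k' y
    using that by (simp add: flat_def B_def)
  interpret L: sgrp "sharp T\<^sub>1" by (rule sharp_sgrp) fact
  interpret K: sgrp "flat T\<^sub>2" by (rule flat_sgrp) fact
  interpret F: sgrp "fun_sgrp (A \<times> B) Q" by (rule fun_sgrp_sgrp) fact
  show ?thesis
    by unfold_locales
      (auto simp: left_precomp_def right_precomp_def fun_sgrp_def fun_eq_iff PiE_iff
        l k sharp_mult flat_mult)
qed

text \<open>The word equation behind this definition: in the context \<open>x w y\<close>, the part of the word that
  starts with the \<open>T\<^sub>2\<close>-prefix of \<open>w\<close> is \<open>w y\<close>. If there is no such prefix, the first block of \<open>w\<close>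
  is merged with \<open>x\<close>, and the left-hand side computes \<open>x w y\<close> instead. Similarly,
  the \<open>T\<^sub>1\<close>-suffix \<open>l x\<close> stands by itself only if \<open>y = I\<close>; otherwise it is the first part of the last
  piece of \<open>r (x, y)\<close>.\<close>

definition represents ::
  "('a, 'm) magma_scheme \<Rightarrow> 'a option set \<Rightarrow> 'a option set \<Rightarrow>
    ('a option \<Rightarrow> 'a option) \<times> ('a option \<times> 'a option \<Rightarrow> 'a option) \<times> ('a option \<Rightarrow> 'a option)
    \<Rightarrow> 'a \<Rightarrow> bool" where
  "represents S A B = (\<lambda>(k, r, l) s. \<forall>x\<in>A. \<forall>y\<in>B.
     k y \<otimes>\<^bsub>adj_id S\<^esub> r (x, y) \<otimes>\<^bsub>adj_id S\<^esub> (if y = None then l x else None) =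
     (if k y = None then x else None) \<otimes>\<^bsub>adj_id S\<^esub> Some s \<otimes>\<^bsub>adj_id S\<^esub> y)"

lemma represents_value:
  assumes "represents S A B (k, r, l) s" "None \<in> A" "None \<in> B"
  shows "k None \<otimes>\<^bsub>adj_id S\<^esub> r (None, None) \<otimes>\<^bsub>adj_id S\<^esub> l None = Some s"
  using assms(1)[unfolded represents_def prod.case, rule_format, OF assms(2,3)] by simp

locale two_subsemigroups = sgrp S for S :: "'a magma" (structure) +
  fixes T\<^sub>1 T\<^sub>2 :: "'a set"
  assumes T\<^sub>1: "subsgrp T\<^sub>1 S" and T\<^sub>2: "subsgrp T\<^sub>2 S"
begin

definition "T\<^sub>0 = sgrp_generate S (set_product S T\<^sub>1 T\<^sub>2)"

abbreviation "A \<equiv> carrier (adj_id (S\<lparr>carrier := T\<^sub>1\<rparr>))"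
abbreviation "B \<equiv> carrier (adj_id (S\<lparr>carrier := T\<^sub>2\<rparr>))"
abbreviation "K \<equiv> flat (S\<lparr>carrier := T\<^sub>2\<rparr>)"
abbreviation "R \<equiv> fun_sgrp (A \<times> B) (adj_id (S\<lparr>carrier := T\<^sub>0\<rparr>))"
abbreviation "L \<equiv> sharp (S\<lparr>carrier := T\<^sub>1\<rparr>)"
abbreviation "P \<equiv> triple_product K R L (left_precomp A B) (right_precomp A B)"

lemma T\<^sub>0: "subsgrp T\<^sub>0 S"
  unfolding T\<^sub>0_def
proof (rule sgrp_generate_subsgrp)
  show "sgrp S" by unfold_locales
  show "set_product S T\<^sub>1 T\<^sub>2 \<subseteq> carrier S"
    using T\<^sub>1 T\<^sub>2 by (auto simp: set_product_def subsgrp_def intro!: closed)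
qed

sublocale S\<^sub>I: sgrp "adj_id S"
  by (rule adj_id_sgrp) unfold_locales

lemma sgrp_subsemigroups:
  "sgrp (S\<lparr>carrier := T\<^sub>0\<rparr>)" "sgrp (S\<lparr>carrier := T\<^sub>1\<rparr>)" "sgrp (S\<lparr>carrier := T\<^sub>2\<rparr>)"
  using subsgrp_imp_sgrp[OF sgrp_axioms] T\<^sub>0 T\<^sub>1 T\<^sub>2 by auto

sublocale triple_product_data K R L "left_precomp A B" "right_precomp A B"
  by (intro precomposition_triple_product_data adj_id_sgrp sgrp_subsemigroups)

lemma in_S\<^sub>I:
  "x \<in> A \<Longrightarrow> x \<in> carrier (adj_id S)"
  "y \<in> B \<Longrightarrow> y \<in> carrier (adj_id S)"
  "z \<in> carrier (adj_id (S\<lparr>carrier := T\<^sub>0\<rparr>)) \<Longrightarrow> z \<in> carrier (adj_id S)"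
  using T\<^sub>0 T\<^sub>1 T\<^sub>2 adj_id_restrict_carrier unfolding subsgrp_def by blast+

text \<open>The two cases correspond to whether the second word begins in \<open>T\<^sub>2\<close>. If it does not, the
  suffix of the first word is the context of the second one. If it does, the prefix of the second
  word is the context of the first one, whose equation already accounts for it.\<close>

lemma represents_mult:
  assumes t: "t \<in> carrier P" "represents S A B t s" and s: "s \<in> carrier S"
    and t': "t' \<in> carrier P" "represents S A B t' s'" and s': "s' \<in> carrier S"
  shows "represents S A B (t \<otimes>\<^bsub>P\<^esub> t') (s \<otimes> s')"
proof -
  obtain k r l k' r' l' where tt: "t = (k, r, l)" "t' = (k', r', l')"
    by (cases t; cases t')
  have k: "k \<in> carrier K" and r: "r \<in> carrier R" and l: "l \<in> carrier L"
    and k': "k' \<in> carrier K" and r': "r' \<in> carrier R" and l': "l' \<in> carrier L"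
    using t t' by (auto simp: tt triple_product_def)
  note S\<^sub>I.assoc [simp] S\<^sub>I.closed [simp]
  have prod: "t \<otimes>\<^bsub>P\<^esub> t' = (k \<otimes>\<^bsub>K\<^esub> k', right_precomp A B r k' \<otimes>\<^bsub>R\<^esub> left_precomp A B l r', l \<otimes>\<^bsub>L\<^esub> l')"
    by (simp add: tt triple_product_def)
  have "k (k' y) \<otimes>\<^bsub>adj_id S\<^esub> (r (x, k' y) \<otimes>\<^bsub>adj_id S\<^esub> r' (l x, y))
        \<otimes>\<^bsub>adj_id S\<^esub> (if y = None then l' (l x) else None) =
      (if k (k' y) = None then x else None) \<otimes>\<^bsub>adj_id S\<^esub> Some (s \<otimes> s') \<otimes>\<^bsub>adj_id S\<^esub> y"
    if x: "x \<in> A" and y: "y \<in> B" for x y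
  proof -
    define c where "c = (if k (k' y) = None then x else None)"
    define q where "q = (if y = None then l' (l x) else None)"
    have lx: "l x \<in> A" and ky: "k' y \<in> B"
      using sharp_maps flat_maps sgrp_subsemigroups l k' x y by auto
    have carr: "k (k' y) \<in> carrier (adj_id S)" "r (x, k' y) \<in> carrier (adj_id S)"
      "r' (l x, y) \<in> carrier (adj_id S)" "l x \<in> carrier (adj_id S)" "k' y \<in> carrier (adj_id S)"
      "y \<in> carrier (adj_id S)" "c \<in> carrier (adj_id S)" "q \<in> carrier (adj_id S)"
      "Some s \<in> carrier (adj_id S)" "Some s' \<in> carrier (adj_id S)"
      using flat_maps[OF _ k ky] sharp_maps[OF _ l' lx] r r' x y lx ky sgrp_subsemigroups in_S\<^sub>I s s'
      by (auto simp: fun_sgrp_def PiE_iff c_def q_def)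
    have rep: "k (k' y) \<otimes>\<^bsub>adj_id S\<^esub> r (x, k' y) \<otimes>\<^bsub>adj_id S\<^esub> (if k' y = None then l x else None) =
        c \<otimes>\<^bsub>adj_id S\<^esub> Some s \<otimes>\<^bsub>adj_id S\<^esub> k' y"
      using t(2)[unfolded tt represents_def prod.case, rule_format, OF x ky] by (simp only: c_def)
    have rep': "k' y \<otimes>\<^bsub>adj_id S\<^esub> r' (l x, y) \<otimes>\<^bsub>adj_id S\<^esub> q =
        (if k' y = None then l x else None) \<otimes>\<^bsub>adj_id S\<^esub> Some s' \<otimes>\<^bsub>adj_id S\<^esub> y"
      using t'(2)[unfolded tt represents_def prod.case, rule_format, OF lx y] by (simp only: q_def)
    have "k (k' y) \<otimes>\<^bsub>adj_id S\<^esub> (r (x, k' y) \<otimes>\<^bsub>adj_id S\<^esub> r' (l x, y)) \<otimes>\<^bsub>adj_id S\<^esub> q =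
        c \<otimes>\<^bsub>adj_id S\<^esub> Some s \<otimes>\<^bsub>adj_id S\<^esub> (Some s' \<otimes>\<^bsub>adj_id S\<^esub> y)"
    proof (cases "k' y = None")
      case True
      have "k (k' y) \<otimes>\<^bsub>adj_id S\<^esub> (r (x, k' y) \<otimes>\<^bsub>adj_id S\<^esub> r' (l x, y)) \<otimes>\<^bsub>adj_id S\<^esub> q =
          k (k' y) \<otimes>\<^bsub>adj_id S\<^esub> r (x, k' y) \<otimes>\<^bsub>adj_id S\<^esub> (r' (l x, y) \<otimes>\<^bsub>adj_id S\<^esub> q)"
        using carr by simp
      also have "r' (l x, y) \<otimes>\<^bsub>adj_id S\<^esub> q = l x \<otimes>\<^bsub>adj_id S\<^esub> (Some s' \<otimes>\<^bsub>adj_id S\<^esub> y)"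
        using rep' True carr by simp
      also have "k (k' y) \<otimes>\<^bsub>adj_id S\<^esub> r (x, k' y) \<otimes>\<^bsub>adj_id S\<^esub> (l x \<otimes>\<^bsub>adj_id S\<^esub> (Some s' \<otimes>\<^bsub>adj_id S\<^esub> y)) =
          k (k' y) \<otimes>\<^bsub>adj_id S\<^esub> r (x, k' y) \<otimes>\<^bsub>adj_id S\<^esub> l x \<otimes>\<^bsub>adj_id S\<^esub> (Some s' \<otimes>\<^bsub>adj_id S\<^esub> y)"
        using carr by simp
      also have "k (k' y) \<otimes>\<^bsub>adj_id S\<^esub> r (x, k' y) \<otimes>\<^bsub>adj_id S\<^esub> l x = c \<otimes>\<^bsub>adj_id S\<^esub> Some s"
        using rep True by simp
      finally show ?thesis .
    next
      case False
      have "k (k' y) \<otimes>\<^bsub>adj_id S\<^esub> (r (x, k' y) \<otimes>\<^bsub>adj_id S\<^esub> r' (l x, y)) \<otimes>\<^bsub>adj_id S\<^esub> q =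
          k (k' y) \<otimes>\<^bsub>adj_id S\<^esub> r (x, k' y) \<otimes>\<^bsub>adj_id S\<^esub> (r' (l x, y) \<otimes>\<^bsub>adj_id S\<^esub> q)"
        using carr by simp
      also have "k (k' y) \<otimes>\<^bsub>adj_id S\<^esub> r (x, k' y) = c \<otimes>\<^bsub>adj_id S\<^esub> Some s \<otimes>\<^bsub>adj_id S\<^esub> k' y"
        using rep False by simp
      also have "c \<otimes>\<^bsub>adj_id S\<^esub> Some s \<otimes>\<^bsub>adj_id S\<^esub> k' y \<otimes>\<^bsub>adj_id S\<^esub> (r' (l x, y) \<otimes>\<^bsub>adj_id S\<^esub> q) =
          c \<otimes>\<^bsub>adj_id S\<^esub> Some s \<otimes>\<^bsub>adj_id S\<^esub> (k' y \<otimes>\<^bsub>adj_id S\<^esub> r' (l x, y) \<otimes>\<^bsub>adj_id S\<^esub> q)"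
        using carr by simp
      also have "k' y \<otimes>\<^bsub>adj_id S\<^esub> r' (l x, y) \<otimes>\<^bsub>adj_id S\<^esub> q = Some s' \<otimes>\<^bsub>adj_id S\<^esub> y"
        using rep' False by simp
      finally show ?thesis .
    qed
    also have "\<dots> = c \<otimes>\<^bsub>adj_id S\<^esub> Some (s \<otimes> s') \<otimes>\<^bsub>adj_id S\<^esub> y"
      using carr by (simp flip: adj_id_mult_simps(3))
    finally show ?thesis
      by (simp add: c_def q_def)
  qed
  moreover have "(k \<otimes>\<^bsub>K\<^esub> k') y = k (k' y)" if "y \<in> B" for y
    using that by (simp add: flat_def)
  moreover have "(l \<otimes>\<^bsub>L\<^esub> l') x = l' (l x)" if "x \<in> A" for x
    using that by (simp add: sharp_def)
  moreover have "(right_precomp A B r k' \<otimes>\<^bsub>R\<^esub> left_precomp A B l r') (x, y) =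
      r (x, k' y) \<otimes>\<^bsub>adj_id S\<^esub> r' (l x, y)" if "x \<in> A" "y \<in> B" for x y
    using that by (simp add: fun_sgrp_def left_precomp_def right_precomp_def)
  ultimately show ?thesis
    unfolding prod represents_def prod.case by (intro ballI) presburger
qed

text \<open>A letter from \<open>T\<^sub>1\<close> carries a piece of \<open>T\<^sub>1T\<^sub>2\<close> exactly when its right context is not \<open>I\<close>. For a
  letter from \<open>T\<^sub>2\<close> the middle part is always \<open>I\<close>: a piece that it completes is charged to the left
  context.\<close>

lemma represents_left_letter:
  assumes a: "a \<in> T\<^sub>1"
  shows "\<exists>t\<in>carrier P. represents S A B t a"
proof -
  let ?k = "\<lambda>y\<in>B. None :: 'a option"
  let ?l = "\<lambda>x\<in>A. x \<otimes>\<^bsub>adj_id S\<^esub> Some a"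
  let ?r = "\<lambda>(x, y)\<in>A \<times> B. if y = None then None else x \<otimes>\<^bsub>adj_id S\<^esub> Some a \<otimes>\<^bsub>adj_id S\<^esub> y"
  have piece: "x \<otimes>\<^bsub>adj_id S\<^esub> Some a \<otimes>\<^bsub>adj_id S\<^esub> y \<in> carrier (adj_id (S\<lparr>carrier := T\<^sub>0\<rparr>))"
    if "x \<in> A" "y \<in> B" "y \<noteq> None" for x y
  proof -
    obtain b where b: "y = Some b" "b \<in> T\<^sub>2"
      using \<open>y \<in> B\<close> \<open>y \<noteq> None\<close> by (auto simp: adj_id_def)
    obtain a' where a': "x \<otimes>\<^bsub>adj_id S\<^esub> Some a = Some a'" "a' \<in> T\<^sub>1"
      using \<open>x \<in> A\<close> a T\<^sub>1 by (cases x) (auto simp: subsgrp_def)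
    have "a' \<otimes> b \<in> T\<^sub>0"
      unfolding T\<^sub>0_def by (rule sgrp_generate.incl) (use a' b in \<open>auto simp: set_product_def\<close>)
    then show ?thesis by (simp add: a' b)
  qed
  have "?k \<in> carrier K" by (auto simp: flat_def)
  moreover have "?l \<in> carrier L" using a by (auto simp: sharp_def)
  moreover have "?r \<in> carrier R" using piece by (auto simp: fun_sgrp_def)
  ultimately have "(?k, ?r, ?l) \<in> carrier P" by (simp add: triple_product_def)
  moreover have "represents S A B (?k, ?r, ?l) a" by (auto simp: represents_def)
  ultimately show ?thesis by blast
qed

lemma represents_right_letter:
  assumes b: "b \<in> T\<^sub>2"
  shows "\<exists>t\<in>carrier P. represents S A B t b"
proof -
  let ?k = "\<lambda>y\<in>B. Some b \<otimes>\<^bsub>adj_id S\<^esub> y"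
  let ?l = "\<lambda>x\<in>A. None :: 'a option"
  let ?r = "\<lambda>(x, y)\<in>A \<times> B. None :: 'a option"
  have "?k \<in> carrier K" using b by (auto simp: flat_def)
  moreover have "?l \<in> carrier L" by (auto simp: sharp_def)
  moreover have "?r \<in> carrier R" by (auto simp: fun_sgrp_def)
  ultimately have "(?k, ?r, ?l) \<in> carrier P" by (simp add: triple_product_def)
  moreover have "Some b \<otimes>\<^bsub>adj_id S\<^esub> y \<noteq> None" for y by (cases y) auto
  then have "represents S A B (?k, ?r, ?l) b" by (auto simp: represents_def)
  ultimately show ?thesis by blast
qed

lemma represents_generated:
  assumes "s \<in> sgrp_generate S (T\<^sub>1 \<union> T\<^sub>2)"
  shows "s \<in> carrier S \<and> (\<exists>t\<in>carrier P. represents S A B t s)"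
  using assms
proof (induction rule: sgrp_generate.induct)
  case (incl a)
  then show ?case
    using represents_left_letter represents_right_letter T\<^sub>1 T\<^sub>2 by (auto simp: subsgrp_def)
next
  case (mult s s')
  then show ?case
    using represents_mult sgrp.closed[OF triple_product_sgrp] closed by metis
qed

theorem divides_triple_product:
  assumes gen: "sgrp_generate S (T\<^sub>1 \<union> T\<^sub>2) = carrier S"
  shows "sgrp_divides S P"
proof -
  define U where "U = {t \<in> carrier P. \<exists>s\<in>carrier S. represents S A B t s}"
  define h :: "('a option \<Rightarrow> 'a option) \<times> ('a option \<times> 'a option \<Rightarrow> 'a option) \<times> ('a option \<Rightarrow> 'a option) \<Rightarrow> 'a"
    where "h = (\<lambda>(k, r, l). the (k None \<otimes>\<^bsub>adj_id S\<^esub> r (None, None) \<otimes>\<^bsub>adj_id S\<^esub> l None))"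
  have h: "h t = s" if "represents S A B t s" for t s
  proof -
    obtain k r l where t: "t = (k, r, l)" by (cases t)
    show ?thesis
      using represents_value[of S A B k r l s] that by (simp add: t h_def)
  qed
  have mult: "t \<otimes>\<^bsub>P\<^esub> t' \<in> U \<and> h (t \<otimes>\<^bsub>P\<^esub> t') = h t \<otimes> h t'" if "t \<in> U" "t' \<in> U" for t t'
  proof -
    obtain s s' where "s \<in> carrier S" "represents S A B t s" "s' \<in> carrier S" "represents S A B t' s'"
      using \<open>t \<in> U\<close> \<open>t' \<in> U\<close> unfolding U_def by blast
    moreover from this have "represents S A B (t \<otimes>\<^bsub>P\<^esub> t') (s \<otimes> s')"
      using that by (intro represents_mult) (auto simp: U_def)
    ultimately show ?thesis
      using that h closed sgrp.closed[OF triple_product_sgrp] by (auto simp: U_def)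
  qed
  have "subsgrp U P"
    using mult by (auto simp: subsgrp_def U_def)
  moreover have img: "h ` U = carrier S"
  proof
    show "h ` U \<subseteq> carrier S" using h by (auto simp: U_def)
    show "carrier S \<subseteq> h ` U"
    proof
      fix s assume s: "s \<in> carrier S"
      then obtain t where "t \<in> carrier P" "represents S A B t s"
        using represents_generated gen by blast
      with s have "t \<in> U" "h t = s"
        using h unfolding U_def by blast+
      then show "s \<in> h ` U" by blast
    qed
  qed
  moreover have "h \<in> sgrp_hom (P\<lparr>carrier := U\<rparr>) S"
    using mult img by (auto simp: sgrp_hom_def)
  ultimately show ?thesis
    unfolding sgrp_divides_def by blast
qed

end

theorem corollary2p3:
  fixes S :: "'a magma" and T\<^sub>0 T\<^sub>1 T\<^sub>2 :: "'a set"
  assumes "sgrp S" and "finite (carrier S)"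
    and "subsgrp T\<^sub>1 S" and "subsgrp T\<^sub>2 S"
    and "sgrp_generate S (T\<^sub>1 \<union> T\<^sub>2) = carrier S"
    and "T\<^sub>0 = sgrp_generate S (set_product S T\<^sub>1 T\<^sub>2)"
  shows "let F = fun_sgrp (carrier (adj_id (S\<lparr>carrier := T\<^sub>1\<rparr>)) \<times> carrier (adj_id (S\<lparr>carrier := T\<^sub>2\<rparr>)))
                   (adj_id (S\<lparr>carrier := T\<^sub>0\<rparr>))
         in \<exists>lact ract.
              triple_product_data
                (flat (S\<lparr>carrier := T\<^sub>2\<rparr>)) F (sharp (S\<lparr>carrier := T\<^sub>1\<rparr>)) lact ract \<and>
              sgrp_divides S
                (triple_product
                  (flat (S\<lparr>carrier := T\<^sub>2\<rparr>)) F (sharp (S\<lparr>carrier := T\<^sub>1\<rparr>)) lact ract)"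
proof -
  interpret two_subsemigroups S T\<^sub>1 T\<^sub>2
    using assms by (simp add: two_subsemigroups_def two_subsemigroups_axioms_def)
  have "T\<^sub>0 = two_subsemigroups.T\<^sub>0 S T\<^sub>1 T\<^sub>2"
    by (simp add: assms(6) T\<^sub>0_def)
  then show ?thesis
    using triple_product_data_axioms divides_triple_product[OF assms(5)]
    unfolding Let_def by blast
qed

end
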